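(* Let $(D,W)$ be a smooth solution on an interval $I\subset(0,\infty)$ of \[D'=-\frac{2x(1-\varepsilon)D(W+\varepsilon)(D-W)}{B},\qquad W'=\frac{1-3W}{x}+\frac{2x(1+\varepsilon)W(W+\varepsilon)(D-W)}{B},\] where $B=D^{-\eta}-[(W+\varepsilon)^2-\varepsilon(W-1)^2+4\varepsilon DW]x^2$, and let $f(x)=J-xD(x)$ with $J=J[x;D]$ as in the context. Then $f$ satisfies \[f'(x)+a[x;D,W]f(x)=b[x;D,W],\qquad x\in I,\] where $a=a_1+a_2$, $b=b_1+\varepsilon b_2$ and \[a_1=\Big(\frac{2\varepsilon xJ+\frac{\varepsilon}{1-\varepsilon}D^{-\eta-1}}{(1-\varepsilon)J+2\varepsilon x(1+D)}+x\Big)\frac{2(1-\varepsilon)D(W+\varepsilon)}{B}-2\varepsilon\Big(\frac1{1-\varepsilon}\frac{D^{-\eta}}{x}+(1-\varepsilon)x+(D+\varepsilon)f\Big)Z^{-1},\] \[a_2=2\varepsilon\big[(J-xW)(D-1)+2f+4\varepsilon x+xD(5+\varepsilon)\big]Z^{-1},\] \[b_1=\frac{D}{H+xW}(xW-J)+\varepsilon(xW-J)Z^{-1}\Big(x(2D^2-2D+1-\varepsilon)+\frac{2}{(1-\varepsilon)x}D^{-\eta}\Big),\] \[b_2=-2x^2\Big\{D\big[D^2+(3+\varepsilon)D-(1-\varepsilon)\big]+\varepsilon\Big[\tfrac4{1-\varepsilon}D^3+\tfrac{2(1+\varepsilon)}{1-\varepsilon}D(1+D)+\tfrac{5-\varepsilon}{1-\varepsilon}D^2+3D-2+\varepsilon\Big]\Big\}Z^{-1},\]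 \[Z=\big[(1-\varepsilon)J+2\varepsilon x(1+D)\big]\big[H+xW\big].\]
   Context: Here $0<\varepsilon<1$, $\eta=\frac{2\varepsilon}{1-\varepsilon}$, $D>0$, and $B\neq0$ along the solution. For $x>0$, $D>0$, \[J[x;D]=-\frac{2\varepsilon}{1-\varepsilon}(1+D)x+\sqrt{\frac{4\varepsilon^2}{(1-\varepsilon)^2}(1+D)^2x^2+\varepsilon x^2+\frac{D^{-\eta}}{1-\varepsilon}},\qquad H[x;D]=J[x;D]+\frac{4\varepsilon}{1-\varepsilon}(1+D)x.\] In all formulas $J=J[x;D(x)]$, $H=H[x;D(x)]$, $D=D(x)$, $W=W(x)$. *)

theory Defs
  imports "HOL-Analysis.Analysis"
begin

text \<open>Infinitely differentiable on \<open>S\<close>: \<open>F n\<close> is the \<open>n\<close>-th derivative of \<open>f\<close> on \<open>S\<close>.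
  Derivatives are taken within \<open>S\<close>, hence one-sided at endpoints that belong to an interval \<open>S\<close>
  and two-sided at interior points.\<close>

definition smooth_on :: "real set \<Rightarrow> (real \<Rightarrow> real) \<Rightarrow> bool" where
  "smooth_on S f \<longleftrightarrow>
     (\<exists>F. (\<forall>x\<in>S. F 0 x = f x) \<and>
          (\<forall>n::nat. \<forall>x\<in>S. (F n has_real_derivative F (Suc n) x) (at x within S)))"

text \<open>In the functions below the arguments \<open>D\<close> and \<open>W\<close> are real values; \<open>\<epsilon>\<close> always comes first.\<close>

definition eta :: "real \<Rightarrow> real" where
  "eta \<epsilon> = 2 * \<epsilon> / (1 - \<epsilon>)"

definition JJ :: "real \<Rightarrow> real \<Rightarrow> real \<Rightarrow> real" where
  "JJ \<epsilon> x D = - (2 * \<epsilon> / (1 - \<epsilon>)) * (1 + D) * x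
     + sqrt (4 * \<epsilon>^2 / (1 - \<epsilon>)^2 * (1 + D)^2 * x^2 + \<epsilon> * x^2 + D powr (- eta \<epsilon>) / (1 - \<epsilon>))"

definition HH :: "real \<Rightarrow> real \<Rightarrow> real \<Rightarrow> real" where
  "HH \<epsilon> x D = JJ \<epsilon> x D + 4 * \<epsilon> / (1 - \<epsilon>) * (1 + D) * x"

definition BB :: "real \<Rightarrow> real \<Rightarrow> real \<Rightarrow> real \<Rightarrow> real" where
  "BB \<epsilon> x D W = D powr (- eta \<epsilon>) - ((W + \<epsilon>)^2 - \<epsilon> * (W - 1)^2 + 4 * \<epsilon> * D * W) * x^2"

definition ff :: "real \<Rightarrow> real \<Rightarrow> real \<Rightarrow> real" where
  "ff \<epsilon> x D = JJ \<epsilon> x D - x * D"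

definition ZZ :: "real \<Rightarrow> real \<Rightarrow> real \<Rightarrow> real \<Rightarrow> real" where
  "ZZ \<epsilon> x D W = ((1 - \<epsilon>) * JJ \<epsilon> x D + 2 * \<epsilon> * x * (1 + D)) * (HH \<epsilon> x D + x * W)"

definition a1 :: "real \<Rightarrow> real \<Rightarrow> real \<Rightarrow> real \<Rightarrow> real" where
  "a1 \<epsilon> x D W =
     ((2 * \<epsilon> * x * JJ \<epsilon> x D + \<epsilon> / (1 - \<epsilon>) * D powr (- eta \<epsilon> - 1))
        / ((1 - \<epsilon>) * JJ \<epsilon> x D + 2 * \<epsilon> * x * (1 + D)) + x)
       * (2 * (1 - \<epsilon>) * D * (W + \<epsilon>) / BB \<epsilon> x D W)
     - 2 * \<epsilon> * (1 / (1 - \<epsilon>) * (D powr (- eta \<epsilon>) / x) + (1 - \<epsilon>) * x + (D + \<epsilon>) * ff \<epsilon> x D)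
       * inverse (ZZ \<epsilon> x D W)"

definition a2 :: "real \<Rightarrow> real \<Rightarrow> real \<Rightarrow> real \<Rightarrow> real" where
  "a2 \<epsilon> x D W =
     2 * \<epsilon> * ((JJ \<epsilon> x D - x * W) * (D - 1) + 2 * ff \<epsilon> x D + 4 * \<epsilon> * x + x * D * (5 + \<epsilon>))
       * inverse (ZZ \<epsilon> x D W)"

definition a_coeff :: "real \<Rightarrow> real \<Rightarrow> real \<Rightarrow> real \<Rightarrow> real" where
  "a_coeff \<epsilon> x D W = a1 \<epsilon> x D W + a2 \<epsilon> x D W"

definition b1 :: "real \<Rightarrow> real \<Rightarrow> real \<Rightarrow> real \<Rightarrow> real" where
  "b1 \<epsilon> x D W =
     D / (HH \<epsilon> x D + x * W) * (x * W - JJ \<epsilon> x D)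
     + \<epsilon> * (x * W - JJ \<epsilon> x D) * inverse (ZZ \<epsilon> x D W)
       * (x * (2 * D^2 - 2 * D + 1 - \<epsilon>) + 2 / ((1 - \<epsilon>) * x) * D powr (- eta \<epsilon>))"

definition b2 :: "real \<Rightarrow> real \<Rightarrow> real \<Rightarrow> real \<Rightarrow> real" where
  "b2 \<epsilon> x D W =
     - 2 * x^2 *
     (D * (D^2 + (3 + \<epsilon>) * D - (1 - \<epsilon>))
      + \<epsilon> * (4 / (1 - \<epsilon>) * D^3 + 2 * (1 + \<epsilon>) / (1 - \<epsilon>) * D * (1 + D)
             + (5 - \<epsilon>) / (1 - \<epsilon>) * D^2 + 3 * D - 2 + \<epsilon>))
     * inverse (ZZ \<epsilon> x D W)"

definition b_coeff :: "real \<Rightarrow> real \<Rightarrow> real \<Rightarrow> real \<Rightarrow> real" where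
  "b_coeff \<epsilon> x D W = b1 \<epsilon> x D W + \<epsilon> * b2 \<epsilon> x D W"

end

theory Submission
  imports Defs
begin

text \<open>
  For fixed \<open>D\<close>, the function \<open>J\<close> is the root \<open>- p + sqrt (p\<^sup>2 + q)\<close> of \<open>J\<^sup>2 + 2 p J = q\<close> with
  \<open>p = 2 \<epsilon> (1 + D) x / (1 - \<epsilon>)\<close>. Hence \<open>D\<^sup>-\<^sup>\<eta>\<close> is a polynomial in \<open>J\<close>, \<open>x\<close>, \<open>D\<close>, and \<open>B\<close> factors as
  \<open>(1 - \<epsilon>) (J - x W) (H + x W)\<close>. In \<open>f' + a f\<close> the term of \<open>f'\<close> that carries \<open>D'\<close> and the first
  summand of \<open>a\<^sub>1 f\<close> have the common factor \<open>2 (1 - \<epsilon>) D (W + \<epsilon>) / B\<close>, and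
  \<open>x (D - W) + f = J - x W\<close> cancels against the factor of \<open>B\<close>. After multiplication by \<open>Z\<close>,
  a polynomial identity remains.
\<close>

text \<open>Implicit differentiation: the root \<open>r\<close> satisfies
  \<open>r^2 + 2 * p * r = q\<close>, so \<open>r' * (r + p) = q' / 2 - p' * r\<close>, and
  \<open>r + p\<close> is the square root. Keeping \<open>r\<close> in the numerator lets the
  derivative of \<open>J\<close> be written through \<open>J\<close> itself.\<close>

lemma has_real_derivative_quadratic_root:
  fixes p q :: "real \<Rightarrow> real"
  assumes p: "(p has_real_derivative p') (at x within S)"
    and q: "(q has_real_derivative q') (at x within S)"
    and pos: "p x ^ 2 + q x > 0"
  shows "((\<lambda>y. - p y + sqrt (p y ^ 2 + q y)) has_real_derivative
     (q' / 2 - p' * (- p x + sqrt (p x ^ 2 + q x))) / sqrt (p x ^ 2 + q x)) (at x within S)"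
proof -
  have "((\<lambda>y. p y ^ 2 + q y) has_real_derivative 2 * p x * p' + q') (at x within S)"
    by (rule derivative_eq_intros p q refl | simp)+
  from DERIV_chain2[OF DERIV_real_sqrt[OF pos] this]
  have "((\<lambda>y. sqrt (p y ^ 2 + q y)) has_real_derivative
      inverse (sqrt (p x ^ 2 + q x)) / 2 * (2 * p x * p' + q')) (at x within S)" .
  from DERIV_add[OF DERIV_minus[OF p] this] show ?thesis
    by (rule DERIV_cong) (use pos in \<open>simp add: field_simps\<close>)
qed

lemma JJ_eq:
  "JJ \<epsilon> x D = - (2 * \<epsilon> / (1 - \<epsilon>) * (1 + D) * x)
     + sqrt ((2 * \<epsilon> / (1 - \<epsilon>) * (1 + D) * x) ^ 2 + (\<epsilon> * x ^ 2 + D powr (- eta \<epsilon>) / (1 - \<epsilon>)))"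
  by (simp add: JJ_def power_mult_distrib power_divide add.assoc)

lemma JJ_radicand_pos:
  assumes "0 < \<epsilon>" "\<epsilon> < 1" "0 < D"
  shows "(2 * \<epsilon> / (1 - \<epsilon>) * (1 + D) * x) ^ 2 + (\<epsilon> * x ^ 2 + D powr (- eta \<epsilon>) / (1 - \<epsilon>)) > 0"
  using assms by (intro add_nonneg_pos) auto

text \<open>The left side is \<open>1 - \<epsilon>\<close> times the square root in
  \<open>J\<close>. It is the first factor of \<open>Z\<close> and also the denominator in the
  derivative of \<open>J\<close>.\<close>

lemma JJ_plus_pos:
  assumes "0 < \<epsilon>" "\<epsilon> < 1" "0 < D"
  shows "(1 - \<epsilon>) * JJ \<epsilon> x D + 2 * \<epsilon> * x * (1 + D) > 0"
proof -
  have "(1 - \<epsilon>) * JJ \<epsilon> x D + 2 * \<epsilon> * x * (1 + D) = (1 - \<epsilon>) *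
      sqrt ((2 * \<epsilon> / (1 - \<epsilon>) * (1 + D) * x) ^ 2 + (\<epsilon> * x ^ 2 + D powr (- eta \<epsilon>) / (1 - \<epsilon>)))"
    unfolding JJ_eq distrib_left[of "1 - \<epsilon>" "- _"] using assms by simp
  then show ?thesis
    using JJ_radicand_pos[OF assms, of x] assms by simp
qed

text \<open>The quadratic for \<open>J\<close>, cleared of its denominator. It eliminates the real
  power of \<open>D\<close>, so that later identities are algebraic with \<open>J\<close> as a free
  variable.\<close>

lemma powr_eta_eq:
  assumes "0 < \<epsilon>" "\<epsilon> < 1" "0 < D"
  shows "D powr (- eta \<epsilon>) =
    (1 - \<epsilon>) * JJ \<epsilon> x D ^ 2 + 4 * \<epsilon> * (1 + D) * x * JJ \<epsilon> x D - \<epsilon> * (1 - \<epsilon>) * x ^ 2"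
proof -
  define p where "p = 2 * \<epsilon> / (1 - \<epsilon>) * (1 + D) * x"
  define q where "q = \<epsilon> * x ^ 2 + D powr (- eta \<epsilon>) / (1 - \<epsilon>)"
  have J: "JJ \<epsilon> x D = - p + sqrt (p ^ 2 + q)"
    by (simp add: JJ_eq p_def q_def)
  have "p ^ 2 + q > 0"
    using JJ_radicand_pos[OF assms, of x] by (simp add: p_def q_def)
  then have "(JJ \<epsilon> x D + p) ^ 2 = p ^ 2 + q"
    by (simp add: J)
  then have "q = JJ \<epsilon> x D ^ 2 + 2 * p * JJ \<epsilon> x D"
    by (simp add: power2_eq_square algebra_simps)
  then have "(1 - \<epsilon>) * JJ \<epsilon> x D ^ 2 + 2 * ((1 - \<epsilon>) * p) * JJ \<epsilon> x D = (1 - \<epsilon>) * q"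
    by (simp add: algebra_simps)
  moreover have "(1 - \<epsilon>) * p = 2 * \<epsilon> * (1 + D) * x"
    using assms by (simp add: p_def)
  moreover have "(1 - \<epsilon>) * q = (1 - \<epsilon>) * \<epsilon> * x ^ 2 + D powr (- eta \<epsilon>)"
    using assms by (simp add: q_def distrib_left)
  ultimately show ?thesis
    by (simp only:) (simp add: algebra_simps)
qed

text \<open>Once the power of \<open>D\<close> is eliminated, \<open>B\<close> is the difference of
  \<open>(1 - \<epsilon>) * t^2 + 4 * \<epsilon> * (1 + D) * x * t\<close> at \<open>t = J\<close>
  and \<open>t = x * W\<close>, hence divisible by \<open>J - x * W\<close>.\<close>

lemma BB_factor:
  assumes "0 < \<epsilon>" "\<epsilon> < 1" "0 < D"
  shows "BB \<epsilon> x D W = (1 - \<epsilon>) * (JJ \<epsilon> x D - x * W) * (HH \<epsilon> x D + x * W)"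
proof -
  have H: "(1 - \<epsilon>) * (HH \<epsilon> x D + x * W) = (1 - \<epsilon>) * (JJ \<epsilon> x D + x * W) + 4 * \<epsilon> * (1 + D) * x"
    using assms by (simp add: HH_def distrib_left)
  have "BB \<epsilon> x D W = (JJ \<epsilon> x D - x * W) * ((1 - \<epsilon>) * (HH \<epsilon> x D + x * W))"
    unfolding BB_def powr_eta_eq[OF assms, of x] H by algebra
  then show ?thesis
    by (simp add: mult_ac)
qed

text \<open>The rule for quadratic roots along \<open>D\<close>, with numerator and denominator
  scaled by \<open>1 - \<epsilon>\<close> so that the denominator becomes the first factor of
  \<open>Z\<close>.\<close>

lemma has_real_derivative_JJ:
  fixes D :: "real \<Rightarrow> real"
  assumes \<epsilon>: "0 < \<epsilon>" "\<epsilon> < 1" and Dpos: "0 < D x"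
    and D: "(D has_real_derivative D') (at x within S)"
  shows "((\<lambda>y. JJ \<epsilon> y (D y)) has_real_derivative
     (\<epsilon> * (1 - \<epsilon>) * x - \<epsilon> / (1 - \<epsilon>) * D x powr (- eta \<epsilon> - 1) * D'
        - 2 * \<epsilon> * (1 + D x + x * D') * JJ \<epsilon> x (D x))
     / ((1 - \<epsilon>) * JJ \<epsilon> x (D x) + 2 * \<epsilon> * x * (1 + D x))) (at x within S)"
proof -
  define p where "p y = 2 * \<epsilon> / (1 - \<epsilon>) * (1 + D y) * y" for y
  define q where "q y = \<epsilon> * y ^ 2 + D y powr (- eta \<epsilon>) / (1 - \<epsilon>)" for y
  define p' where "p' = 2 * \<epsilon> / (1 - \<epsilon>) * (1 + D x + x * D')"
  define q' where "q' = 2 * \<epsilon> * x - eta \<epsilon> * D x powr (- eta \<epsilon> - 1) * D' / (1 - \<epsilon>)"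
  define s where "s = sqrt (p x ^ 2 + q x)"
  have J: "(\<lambda>y. JJ \<epsilon> y (D y)) = (\<lambda>y. - p y + sqrt (p y ^ 2 + q y))"
    by (simp add: JJ_eq p_def q_def)
  have Jx: "JJ \<epsilon> x (D x) = - p x + s"
    by (simp add: JJ_eq p_def q_def s_def)
  have dp: "(p has_real_derivative p') (at x within S)"
    unfolding p_def p'_def
    by (rule derivative_eq_intros D refl)+ (simp add: add_divide_distrib algebra_simps)
  have "((\<lambda>y. D y powr (- eta \<epsilon>)) has_real_derivative
      - eta \<epsilon> * D x powr (- eta \<epsilon> - 1) * D') (at x within S)"
    by (rule DERIV_chain2[OF has_real_derivative_powr[OF Dpos] D])
  then have dq: "(q has_real_derivative q') (at x within S)"
    unfolding q_def q'_def
    using Dpos \<epsilon> by (auto intro!: derivative_eq_intros D)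
  have pos: "p x ^ 2 + q x > 0"
    using JJ_radicand_pos[where x = x, OF \<epsilon> Dpos] by (simp add: p_def q_def)
  then have s: "s > 0"
    by (simp add: s_def)
  have den: "(1 - \<epsilon>) * JJ \<epsilon> x (D x) + 2 * \<epsilon> * x * (1 + D x) = (1 - \<epsilon>) * s"
    unfolding Jx p_def distrib_left[of "1 - \<epsilon>" "- _"] using \<epsilon> by simp
  \<comment> \<open>The coefficient of the power comes from
    \<open>eta \<epsilon> / 2 = \<epsilon> / (1 - \<epsilon>)\<close>.\<close>
  have "\<epsilon> * (1 - \<epsilon>) * x - \<epsilon> / (1 - \<epsilon>) * D x powr (- eta \<epsilon> - 1) * D' = (1 - \<epsilon>) * (q' / 2)"
  proof -
    have q': "q' / 2 = \<epsilon> * x - \<epsilon> / (1 - \<epsilon>) * D x powr (- eta \<epsilon> - 1) * D' / (1 - \<epsilon>)"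
      unfolding q'_def eta_def[of \<epsilon>] by (simp add: diff_divide_distrib)
    show ?thesis
      unfolding q' right_diff_distrib[of "1 - \<epsilon>" "_ * x"] using \<epsilon> by simp
  qed
  moreover have "2 * \<epsilon> * (1 + D x + x * D') = (1 - \<epsilon>) * p'"
    using \<epsilon> by (simp add: p'_def)
  ultimately have num: "\<epsilon> * (1 - \<epsilon>) * x - \<epsilon> / (1 - \<epsilon>) * D x powr (- eta \<epsilon> - 1) * D'
        - 2 * \<epsilon> * (1 + D x + x * D') * JJ \<epsilon> x (D x) = (1 - \<epsilon>) * (q' / 2 - p' * (- p x + s))"
    unfolding Jx by (simp add: right_diff_distrib mult.assoc)
  show ?thesis
    unfolding den num unfolding J
    using has_real_derivative_quadratic_root[OF dp dq pos] \<epsilon> by (simp add: s_def)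
qed

text \<open>Here \<open>P\<close> stands for \<open>D powr (- eta \<epsilon>)\<close>, and the equation for \<open>f' + a f = b\<close> has been
  multiplied by \<open>Z\<close>.\<close>

lemma cleared_identity:
  fixes \<epsilon> x D W J P H :: real
  assumes \<epsilon>: "\<epsilon> \<noteq> 1" and x: "x \<noteq> 0"
    and P: "P = (1 - \<epsilon>) * J ^ 2 + 4 * \<epsilon> * (1 + D) * x * J - \<epsilon> * (1 - \<epsilon>) * x ^ 2"
    and H: "H = J + 4 * \<epsilon> / (1 - \<epsilon>) * (1 + D) * x"
    and S: "S = (1 - \<epsilon>) * J + 2 * \<epsilon> * x * (1 + D)"
  shows "(\<epsilon> * (1 - \<epsilon>) * x - 2 * \<epsilon> * (1 + D) * J) * (H + x * W) - D * S * (H + x * W)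
      + 2 * (W + \<epsilon>) * (2 * \<epsilon> * x * J * D + \<epsilon> / (1 - \<epsilon>) * P + x * S * D)
      - 2 * \<epsilon> * (1 / (1 - \<epsilon>) * (P / x) + (1 - \<epsilon>) * x + (D + \<epsilon>) * (J - x * D)) * (J - x * D)
      + 2 * \<epsilon> * ((J - x * W) * (D - 1) + 2 * (J - x * D) + 4 * \<epsilon> * x + x * D * (5 + \<epsilon>)) * (J - x * D)
    = D * S * (x * W - J)
      + \<epsilon> * (x * W - J) * (x * (2 * D^2 - 2 * D + 1 - \<epsilon>) + 2 / ((1 - \<epsilon>) * x) * P)
      - 2 * \<epsilon> * x^2 *
        (D * (D^2 + (3 + \<epsilon>) * D - (1 - \<epsilon>))
         + \<epsilon> * (4 / (1 - \<epsilon>) * D^3 + 2 * (1 + \<epsilon>) / (1 - \<epsilon>) * D * (1 + D)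
             + (5 - \<epsilon>) / (1 - \<epsilon>) * D^2 + 3 * D - 2 + \<epsilon>))"
proof -
  \<comment> \<open>For a purely polynomial problem, division by \<open>1 - \<epsilon>\<close>
    becomes multiplication by a variable \<open>r\<close> subject to
    \<open>r * (1 - \<epsilon>) = 1\<close>.\<close>
  define r where "r = 1 / (1 - \<epsilon>)"
  have r: "r * (1 - \<epsilon>) = 1"
    using \<epsilon> by (simp add: r_def)
  have d: "t / (1 - \<epsilon>) = t * r" for t
    by (simp add: r_def)
  \<comment> \<open>\<open>Q\<close> is \<open>P / (1 - \<epsilon>)\<close>; the division by
    \<open>x\<close> is likewise encoded by \<open>T\<close> with \<open>T * x = Q\<close>.\<close>
  define Q where "Q = J ^ 2 + 4 * \<epsilon> * r * (1 + D) * x * J - \<epsilon> * x ^ 2"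
  define T where "T = Q / x"
  have PQ: "P = (1 - \<epsilon>) * Q"
    using r unfolding P Q_def by algebra
  have T: "T * x = Q"
    using x by (simp add: T_def)
  have e1: "1 / (1 - \<epsilon>) * (P / x) = T" "2 / ((1 - \<epsilon>) * x) * P = 2 * T" "\<epsilon> / (1 - \<epsilon>) * P = \<epsilon> * Q"
    using \<epsilon> x by (simp_all add: PQ T_def)
  show ?thesis
    unfolding e1 unfolding H S d using r T unfolding Q_def by algebra
qed

theorem lemma3p7:
  fixes \<epsilon> :: real and I :: "real set" and D W :: "real \<Rightarrow> real"
  assumes "0 < \<epsilon>" and "\<epsilon> < 1"
    and "is_interval I" and "I \<subseteq> {0<..}"
    and "smooth_on I D" and "smooth_on I W"
    and "\<And>x. x \<in> I \<Longrightarrow> D x > 0"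
    and "\<And>x. x \<in> I \<Longrightarrow> BB \<epsilon> x (D x) (W x) \<noteq> 0"
    and "\<And>x. x \<in> I \<Longrightarrow>
      (D has_real_derivative
         - (2 * x * (1 - \<epsilon>) * D x * (W x + \<epsilon>) * (D x - W x) / BB \<epsilon> x (D x) (W x)))
      (at x within I)"
    and "\<And>x. x \<in> I \<Longrightarrow>
      (W has_real_derivative
         (1 - 3 * W x) / x
         + 2 * x * (1 + \<epsilon>) * W x * (W x + \<epsilon>) * (D x - W x) / BB \<epsilon> x (D x) (W x))
      (at x within I)"
  shows "\<forall>x\<in>I. \<exists>f'.
    ((\<lambda>y. ff \<epsilon> y (D y)) has_real_derivative f') (at x within I) \<and>
    f' + a_coeff \<epsilon> x (D x) (W x) * ff \<epsilon> x (D x) = b_coeff \<epsilon> x (D x) (W x)"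
proof
  fix x assume xI: "x \<in> I"
  define d w where "d = D x" and "w = W x"
  define J H P B f where "J = JJ \<epsilon> x d" and "H = HH \<epsilon> x d" and "P = d powr (- eta \<epsilon>)"
    and "B = BB \<epsilon> x d w" and "f = ff \<epsilon> x d"
  \<comment> \<open>These are the two factors of \<open>Z\<close>.\<close>
  define S K where "S = (1 - \<epsilon>) * J + 2 * \<epsilon> * x * (1 + d)" and "K = H + x * w"
  define D' where "D' = - (2 * x * (1 - \<epsilon>) * d * (w + \<epsilon>) * (d - w) / B)"
  \<comment> \<open>With \<open>x\<close> and \<open>D\<close> as independent variables,
    \<open>- M\<close> is the partial derivative of \<open>f\<close> in \<open>D\<close> and
    \<open>E / S - d\<close> the one in \<open>x\<close>; \<open>f'\<close> is the chain rule.
    \<open>M\<close> is also the bracket in \<open>a1\<close>.\<close>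
  define M where "M = (2 * \<epsilon> * x * J + \<epsilon> / (1 - \<epsilon>) * (P / d)) / S + x"
  define E where "E = \<epsilon> * (1 - \<epsilon>) * x - 2 * \<epsilon> * (1 + d) * J"
  define f' where "f' = E / S - d - D' * M"
  have \<epsilon>: "0 < \<epsilon>" "\<epsilon> < 1"
    by fact+
  have x: "x > 0"
    using assms(4) xI by auto
  have d: "d > 0"
    using assms(7) xI by (simp add: d_def)
  have S: "S > 0"
    unfolding S_def J_def by (rule JJ_plus_pos[OF \<epsilon> d])
  have B: "B = (1 - \<epsilon>) * (J - x * w) * K"
    unfolding B_def J_def K_def H_def by (rule BB_factor[OF \<epsilon> d])
  have "B \<noteq> 0"
    using assms(8) xI by (simp add: B_def d_def w_def)
  with B have K: "K \<noteq> 0" and G: "J - x * w \<noteq> 0"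
    by auto
  have f: "f = J - x * d"
    by (simp add: f_def ff_def J_def)
  have Pd: "d powr (- eta \<epsilon> - 1) = P / d"
    using d by (simp add: P_def powr_diff)
  have dD: "(D has_real_derivative D') (at x within I)"
    using assms(9)[OF xI] by (simp add: D'_def B_def d_def w_def)
  have "((\<lambda>y. JJ \<epsilon> y (D y)) has_real_derivative
      (\<epsilon> * (1 - \<epsilon>) * x - \<epsilon> / (1 - \<epsilon>) * (P / d) * D' - 2 * \<epsilon> * (1 + d + x * D') * J) / S)
      (at x within I)"
    using has_real_derivative_JJ[where D = D, OF \<epsilon> _ dD] d
    unfolding S_def J_def d_def[symmetric] Pd by simp
  then have "((\<lambda>y. ff \<epsilon> y (D y)) has_real_derivative
      (\<epsilon> * (1 - \<epsilon>) * x - \<epsilon> / (1 - \<epsilon>) * (P / d) * D' - 2 * \<epsilon> * (1 + d + x * D') * J) / S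
      - (d + x * D')) (at x within I)"
    unfolding ff_def d_def by (auto intro!: derivative_eq_intros dD)
  moreover have "(\<epsilon> * (1 - \<epsilon>) * x - \<epsilon> / (1 - \<epsilon>) * (P / d) * D' - 2 * \<epsilon> * (1 + d + x * D') * J) / S
      - (d + x * D') = f'"
  proof -
    have "\<epsilon> * (1 - \<epsilon>) * x - \<epsilon> / (1 - \<epsilon>) * (P / d) * D' - 2 * \<epsilon> * (1 + d + x * D') * J
        = E - D' * (2 * \<epsilon> * x * J + \<epsilon> / (1 - \<epsilon>) * (P / d))"
      unfolding E_def by algebra
    then show ?thesis
      unfolding f'_def M_def by (simp add: diff_divide_distrib distrib_left)
  qed
  ultimately have df: "((\<lambda>y. ff \<epsilon> y (D y)) has_real_derivative f') (at x within I)"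
    by simp
  \<comment> \<open>Numerators over \<open>Z = S * K\<close>: \<open>\<alpha>1\<close> and
    \<open>\<beta>1\<close> belong to the second summands of \<open>a1\<close> and
    \<open>b1\<close>, \<open>\<alpha>2\<close> to \<open>a2\<close>, and \<open>\<beta>2\<close> to
    \<open>- \<epsilon> * b2\<close>.\<close>
  define \<alpha>1 where "\<alpha>1 = 2 * \<epsilon> * (1 / (1 - \<epsilon>) * (P / x) + (1 - \<epsilon>) * x + (d + \<epsilon>) * f)"
  define \<alpha>2 where "\<alpha>2 = 2 * \<epsilon> * ((J - x * w) * (d - 1) + 2 * f + 4 * \<epsilon> * x + x * d * (5 + \<epsilon>))"
  define \<beta>1 where "\<beta>1 = \<epsilon> * (x * w - J)
    * (x * (2 * d^2 - 2 * d + 1 - \<epsilon>) + 2 / ((1 - \<epsilon>) * x) * P)"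
  define \<beta>2 where "\<beta>2 = 2 * \<epsilon> * x^2 * (d * (d^2 + (3 + \<epsilon>) * d - (1 - \<epsilon>))
    + \<epsilon> * (4 / (1 - \<epsilon>) * d^3 + 2 * (1 + \<epsilon>) / (1 - \<epsilon>) * d * (1 + d)
      + (5 - \<epsilon>) / (1 - \<epsilon>) * d^2 + 3 * d - 2 + \<epsilon>))"
  have a: "a_coeff \<epsilon> x d w = M * (2 * (1 - \<epsilon>) * d * (w + \<epsilon>) / B) + (\<alpha>2 - \<alpha>1) / (S * K)"
    unfolding a_coeff_def a1_def a2_def ZZ_def Pd
    by (fold J_def H_def P_def B_def f_def, fold S_def K_def, fold M_def \<alpha>1_def \<alpha>2_def)
      (simp add: divide_inverse left_diff_distrib)
  have b: "b_coeff \<epsilon> x d w = d * S * (x * w - J) / (S * K) + (\<beta>1 - \<beta>2) / (S * K)"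
  proof -
    have "b_coeff \<epsilon> x d w = d / K * (x * w - J) + (\<beta>1 - \<beta>2) / (S * K)"
      unfolding b_coeff_def b1_def b2_def ZZ_def
      by (fold J_def H_def P_def, fold S_def K_def)
        (simp only: \<beta>1_def \<beta>2_def divide_inverse[of _ "S * K"] left_diff_distrib, algebra)
    then show ?thesis
      using S by simp
  qed
  \<comment> \<open>Both terms share a factor, leaving \<open>x * (d - w) + f = J - x * w\<close>,
    which cancels in \<open>B\<close>.\<close>
  have "- D' * M + M * (2 * (1 - \<epsilon>) * d * (w + \<epsilon>) / B) * f
      = M * (2 * d * (w + \<epsilon>)) * ((1 - \<epsilon>) * (J - x * w) / B)"
    unfolding D'_def f by (simp add: divide_inverse) algebra
  also have "(1 - \<epsilon>) * (J - x * w) / B = 1 / K"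
    using B G K \<epsilon> by simp
  also have "M * (2 * d * (w + \<epsilon>)) * (1 / K) = 2 * (w + \<epsilon>) * (M * d * S) / (S * K)"
    using S by simp
  \<comment> \<open>The factor \<open>d\<close> clears \<open>P / d\<close>, and \<open>S\<close>
    clears the denominator in \<open>M\<close>.\<close>
  also have "M * d * S = 2 * \<epsilon> * x * J * d + \<epsilon> / (1 - \<epsilon>) * P + x * S * d"
    using S d \<epsilon> by (simp add: M_def distrib_right) (simp add: field_simps)
  finally have c: "- D' * M + M * (2 * (1 - \<epsilon>) * d * (w + \<epsilon>) / B) * f
      = 2 * (w + \<epsilon>) * (2 * \<epsilon> * x * J * d + \<epsilon> / (1 - \<epsilon>) * P + x * S * d) / (S * K)" .
  have "f' + a_coeff \<epsilon> x d w * f = E / S - d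
      + (- D' * M + M * (2 * (1 - \<epsilon>) * d * (w + \<epsilon>) / B) * f) + (\<alpha>2 - \<alpha>1) / (S * K) * f"
    unfolding f'_def a by (simp add: distrib_right)
  also have "E / S - d = (E * K - d * S * K) / (S * K)"
    using S K by (simp add: field_simps)
  also have "(E * K - d * S * K) / (S * K)
      + (- D' * M + M * (2 * (1 - \<epsilon>) * d * (w + \<epsilon>) / B) * f) + (\<alpha>2 - \<alpha>1) / (S * K) * f
    = (E * K - d * S * K + 2 * (w + \<epsilon>) * (2 * \<epsilon> * x * J * d + \<epsilon> / (1 - \<epsilon>) * P + x * S * d)
      - \<alpha>1 * f + \<alpha>2 * f) / (S * K)"
    unfolding c by (simp add: add_divide_distrib diff_divide_distrib left_diff_distrib)
  \<comment> \<open>Everything is now over \<open>Z\<close>, so only the numerators have to be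
    compared.\<close>
  also have "E * K - d * S * K + 2 * (w + \<epsilon>) * (2 * \<epsilon> * x * J * d + \<epsilon> / (1 - \<epsilon>) * P + x * S * d)
      - \<alpha>1 * f + \<alpha>2 * f = d * S * (x * w - J) + \<beta>1 - \<beta>2"
    unfolding E_def K_def \<alpha>1_def \<alpha>2_def \<beta>1_def \<beta>2_def f
    by (rule cleared_identity[OF _ _ _ _ S_def])
      (use \<epsilon> x in \<open>simp_all add: P_def J_def H_def HH_def powr_eta_eq[OF \<epsilon> d, of x]\<close>)
  also have "(d * S * (x * w - J) + \<beta>1 - \<beta>2) / (S * K) = b_coeff \<epsilon> x d w"
    unfolding b by (simp add: add_divide_distrib diff_divide_distrib)
  finally have "f' + a_coeff \<epsilon> x (D x) (W x) * ff \<epsilon> x (D x) = b_coeff \<epsilon> x (D x) (W x)"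
    by (simp add: d_def w_def f_def)
  with df show "\<exists>f'. ((\<lambda>y. ff \<epsilon> y (D y)) has_real_derivative f') (at x within I) \<and>
      f' + a_coeff \<epsilon> x (D x) (W x) * ff \<epsilon> x (D x) = b_coeff \<epsilon> x (D x) (W x)"
    by blast
qed

end
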